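(* Let $G$ be a connected triangle-free graph of order $n$, size $m$ (number of edges), minimum degree $\delta\geq 2$ and vertex-connectivity $\kappa$. If $$m \geq \delta^2+\left\lfloor\tfrac14 (n-\delta)^2\right\rfloor,$$ then $G$ is super-$\kappa$.
   Context: All graphs are finite, simple and undirected. A vertex-cut of a connected graph is a set of vertices whose removal disconnects it; a minimum vertex-cut is one of minimum size. $G$ is super-connected (super-$\kappa$) if every minimum vertex-cut isolates a vertex of minimum degree (i.e., for every minimum vertex-cut $S$, some component of $G-S$ is a single vertex of degree $\delta(G)$). *)

theory Defs
  imports Complex_Main "Graph_Theory.Digraph_Component"
begin

text \<open>
  Finite simple undirected graphs are those of the locale \<open>graph\<close> of the Graph-Theory library:
  finite symmetric digraphs without loops and parallel arcs. An undirected edge is represented by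
  its two opposite arcs, so the number of edges is not the number of arcs; it is the number of
  unordered pairs of end vertices of arcs.
\<close>

definition edges :: "('a, 'b) pre_digraph \<Rightarrow> 'a set set" where
  "edges G = (\<lambda>e. {tail G e, head G e}) ` arcs G"

text \<open>
  In a symmetric digraph the degree of a vertex is its out-degree (which equals its in-degree).
\<close>

definition min_degree :: "('a, 'b) pre_digraph \<Rightarrow> nat" where
  "min_degree G = Min (out_degree G ` verts G)"

definition triangle_free :: "('a, 'b) pre_digraph \<Rightarrow> bool" where
  "triangle_free G \<longleftrightarrow> \<not> (\<exists>u v w. u \<rightarrow>\<^bsub>G\<^esub> v \<and> v \<rightarrow>\<^bsub>G\<^esub> w \<and> w \<rightarrow>\<^bsub>G\<^esub> u)"

text \<open>
  The inclusion is strict because the library does not count the null graph as connected, while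
  deleting all vertices does not disconnect a graph.
\<close>

definition vertex_cut :: "('a, 'b) pre_digraph \<Rightarrow> 'a set \<Rightarrow> bool" where
  "vertex_cut G S \<longleftrightarrow>
     S \<subset> verts G \<and> \<not> Digraph_Component.connected (G \<restriction> (verts G - S))"

definition minimum_vertex_cut :: "('a, 'b) pre_digraph \<Rightarrow> 'a set \<Rightarrow> bool" where
  "minimum_vertex_cut G S \<longleftrightarrow>
     vertex_cut G S \<and> (\<forall>T. vertex_cut G T \<longrightarrow> card S \<le> card T)"

text \<open>
  The components of a symmetric digraph are its strongly connected components. Note that the degree
  of the isolated vertex is taken in \<open>G\<close>, not in \<open>G - S\<close>.
\<close>

definition super_connected :: "('a, 'b) pre_digraph \<Rightarrow> bool" where
  "super_connected G \<longleftrightarrow>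
     (\<forall>S. minimum_vertex_cut G S \<longrightarrow>
        (\<exists>C \<in> pre_digraph.sccs (G \<restriction> (verts G - S)).
           \<exists>v. verts C = {v} \<and> out_degree G v = min_degree G))"

end

theory Submission
  imports Defs
begin

text \<open>
  Suppose a minimum vertex-cut \<open>S\<close> leaves no isolated vertex, and split \<open>V - S\<close> into nonempty parts
  \<open>X\<close>, \<open>Y\<close> without edges between them. The neighbourhoods of the ends of an edge inside \<open>X\<close> are disjoint
  subsets of \<open>X \<union> S\<close>, so \<open>|X| + |S| \<ge> 2\<delta>\<close>, and likewise \<open>|Y| + |S| \<ge> 2\<delta>\<close>. Mantel's theorem in
  \<open>X \<union> S\<close> and in \<open>Y \<union> S\<close>, together with convexity and \<open>|S| \<le> \<delta>\<close>, contradicts the bound on \<open>m\<close>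
  unless \<open>|S| = \<delta>\<close> and one of the sides, say \<open>X\<close>, has exactly \<open>\<delta>\<close> vertices. In that case fewer
  than \<open>\<delta>\<^sup>2\<close> edges meet \<open>X\<close>, which again makes \<open>m\<close> too small.
\<close>

section \<open>Quarter squares rounded down\<close>

lemma quarter_square_add_double:
  "(2 * d + i)\<^sup>2 div 4 = d\<^sup>2 + d * i + i\<^sup>2 div 4" for d i :: nat
proof -
  \<comment> \<open>The two squares differ by a multiple of 4, so rounding down affects only the
    square of \<open>i\<close>.\<close>
  have "(2 * d + i)\<^sup>2 = 4 * (d\<^sup>2 + d * i) + i\<^sup>2"
    by (simp add: power2_eq_square algebra_simps)
  then show ?thesis by simp
qed

lemma mult_le_quarter_square: "a * b \<le> (a + b)\<^sup>2 div 4" for a b :: nat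
proof -
  have "4 * (int a * int b) \<le> (int a + int b)\<^sup>2"
    using zero_le_power2[of "int a - int b"] by (simp add: power2_eq_square algebra_simps)
  then have "int (4 * (a * b)) \<le> int ((a + b)\<^sup>2)" by simp
  then have "4 * (a * b) \<le> (a + b)\<^sup>2" by (simp only: of_nat_le_iff)
  then show ?thesis by simp
qed

lemma quarter_square_superadditive:
  fixes i j :: nat
  shows "i\<^sup>2 div 4 + j\<^sup>2 div 4 \<le> (i + j)\<^sup>2 div 4"
    and "i > 0 \<Longrightarrow> j > 0 \<Longrightarrow> i\<^sup>2 div 4 + j\<^sup>2 div 4 < (i + j)\<^sup>2 div 4"
proof -
  have sq: "(i + j)\<^sup>2 = i\<^sup>2 + j\<^sup>2 + 2 * (i * j)"
    by (simp add: power2_eq_square algebra_simps)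
  then show "i\<^sup>2 div 4 + j\<^sup>2 div 4 \<le> (i + j)\<^sup>2 div 4" by linarith
  assume "i > 0" "j > 0"
  then have "i * j \<ge> 1" by simp
  show "i\<^sup>2 div 4 + j\<^sup>2 div 4 < (i + j)\<^sup>2 div 4"
  \<comment> \<open>The cross term \<open>2 * (i * j)\<close> gains a whole unit after division by 4
    only from \<open>i * j = 2\<close> on. What remains is \<open>i = j = 1\<close>, where the claim
    reads 0 < 1.\<close>
  proof (cases "i * j = 1")
    case True
    then show ?thesis by (simp add: power2_eq_square)
  next
    case False
    with \<open>i * j \<ge> 1\<close> have "i * j \<ge> 2" by linarith
    with sq show ?thesis by linarith
  qed
qed

text \<open>Here \<open>a\<close> and \<open>b\<close> stand for the sizes of the two sides, each
  taken with a cut of size \<open>s\<close>, so \<open>a + b - s\<close> is the order of the graph.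
  With excesses \<open>i\<close>, \<open>j\<close> over \<open>2 * d\<close> and deficit
  \<open>t = d - s\<close>, the common terms \<open>2 * d\<^sup>2 + d * (i + j)\<close> cancel. The
  strictness left to prove comes from \<open>d * t\<close> if \<open>t > 0\<close>, and otherwise
  from strict superadditivity.\<close>

lemma quarter_square_sum_less:
  fixes a b d s :: nat
  assumes "2 * d \<le> a" "2 * d \<le> b" "s \<le> d" "d > 0"
    and "s = d \<Longrightarrow> 2 * d < a \<and> 2 * d < b"
  shows "a\<^sup>2 div 4 + b\<^sup>2 div 4 < d\<^sup>2 + (a + b - s - d)\<^sup>2 div 4"
proof -
  obtain i j t where ij: "a = 2 * d + i" "b = 2 * d + j" and t: "d = s + t"
    using assms(1-3) by (auto simp: le_iff_add)
  have "a + b - s - d = 2 * d + (i + j + t)" using ij t by simp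
  then have eq: "(a + b - s - d)\<^sup>2 div 4 = d\<^sup>2 + d * (i + j + t) + (i + j + t)\<^sup>2 div 4"
    by (simp only: quarter_square_add_double)
  have "i\<^sup>2 div 4 + j\<^sup>2 div 4 < d * t + (i + j + t)\<^sup>2 div 4"
  proof (cases "t = 0")
    case True
    with assms(5) ij t have "i > 0" "j > 0" by auto
    then show ?thesis using quarter_square_superadditive(2) True by simp
  next
    case False
    have "i\<^sup>2 div 4 + j\<^sup>2 div 4 \<le> (i + j + t)\<^sup>2 div 4"
      using quarter_square_superadditive(1)[of i j] quarter_square_superadditive(1)[of "i + j" t]
      by linarith
    moreover have "d * t > 0" using False \<open>d > 0\<close> by simp
    ultimately show ?thesis by linarith
  qed
  then show ?thesis
    unfolding eq by (simp only: ij(1,2) quarter_square_add_double distrib_left)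
qed

section \<open>Triangle-free edge sets and Mantel's theorem\<close>

locale triangle_free_edges =
  fixes E :: "'a set set"
  assumes finite_edges: "finite E"
    and card_edge: "e \<in> E \<Longrightarrow> card e = 2"
    and no_triangle: "{u, v} \<in> E \<Longrightarrow> {v, w} \<in> E \<Longrightarrow> {w, u} \<notin> E"
begin

definition neighbours :: "'a \<Rightarrow> 'a set" where
  "neighbours v = {u. {u, v} \<in> E}"

lemma edge_neq: "{u, v} \<in> E \<Longrightarrow> u \<noteq> v"
  using card_edge[of "{u, v}"] by auto

lemma obtain_edge:
  assumes "e \<in> E" obtains u v where "e = {u, v}"
  using card_edge[OF assms] by (auto simp: card_2_iff)

lemma finite_neighbours: "finite (neighbours v)"
proof (rule finite_subset)
  show "neighbours v \<subseteq> \<Union>E" by (auto simp: neighbours_def)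
  show "finite (\<Union>E)"
    using finite_edges card_edge by (intro finite_Union) (auto intro: card_ge_0_finite)
qed

lemma neighbours_independent: "u \<in> neighbours v \<Longrightarrow> w \<in> neighbours v \<Longrightarrow> {u, w} \<notin> E"
  using no_triangle[of u v w] by (auto simp: neighbours_def insert_commute)

text \<open>This makes \<open>mantel\<close> applicable separately to the edges that meet one side
  and to those that miss it.\<close>

lemma subset_edges: "F \<subseteq> E \<Longrightarrow> triangle_free_edges F"
  using finite_edges card_edge no_triangle
  by unfold_locales (blast intro: finite_subset)+

text \<open>
  The non-neighbours of a vertex of maximum degree \<open>D\<close> cover all edges, so there are at most
  \<open>(n - D) * D\<close> edges.
\<close>
lemma mantel:
  assumes "finite T" "\<And>e. e \<in> E \<Longrightarrow> e \<subseteq> T"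
  shows "card E \<le> (card T)\<^sup>2 div 4"
proof (cases "T = {}")
  case True
  have "E = {}"
  proof (rule equals0I)
    fix e assume "e \<in> E"
    with assms(2) True card_edge show False by fastforce
  qed
  then show ?thesis by simp
next
  case False
  let ?D = "(\<lambda>w. card (neighbours w)) ` T"
  have "Max ?D \<in> ?D" using assms(1) False by (intro Max_in) auto
  then obtain v where "v \<in> T" "Max ?D = card (neighbours v)" by auto
  moreover have "card (neighbours w) \<le> Max ?D" if "w \<in> T" for w
    using assms(1) that by (intro Max_ge) auto
  ultimately have v: "v \<in> T" "\<And>w. w \<in> T \<Longrightarrow> card (neighbours w) \<le> card (neighbours v)"
    by auto
  define N where "N = neighbours v"
  have N: "N \<subseteq> T" using assms(2) by (force simp: N_def neighbours_def)
  have in_star: "{x, y} \<in> (\<Union>w\<in>T - N. (\<lambda>u. {u, w}) ` neighbours w)"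
    if "{x, y} \<in> E" "y \<in> T - N" for x y
    using that by (intro UN_I[of y] imageI) (auto simp: neighbours_def)
  \<comment> \<open>Since \<open>N\<close> is independent, each edge has an end \<open>w\<close>
    outside \<open>N\<close> and so lies in the star at \<open>w\<close>.\<close>
  have "E \<subseteq> (\<Union>w\<in>T - N. (\<lambda>u. {u, w}) ` neighbours w)"
  proof
    fix e assume e: "e \<in> E"
    then obtain a b where ab: "e = {a, b}" by (rule obtain_edge)
    with assms(2)[OF e] have "a \<in> T" "b \<in> T" by auto
    moreover have "\<not> (a \<in> N \<and> b \<in> N)"
      using neighbours_independent e ab by (auto simp: N_def)
    ultimately show "e \<in> (\<Union>w\<in>T - N. (\<lambda>u. {u, w}) ` neighbours w)"
      using in_star[of b a] in_star[of a b] e ab by (auto simp: insert_commute)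
  qed
  then have "card E \<le> card (\<Union>w\<in>T - N. (\<lambda>u. {u, w}) ` neighbours w)"
    using assms(1) finite_neighbours by (intro card_mono) auto
  also have "\<dots> \<le> (\<Sum>w\<in>T - N. card ((\<lambda>u. {u, w}) ` neighbours w))"
    using assms(1) by (intro card_UN_le) auto
  also have "\<dots> \<le> (\<Sum>w\<in>T - N. card N)"
    using v(2) finite_neighbours
    by (intro sum_mono) (auto simp: N_def intro: order_trans[OF card_image_le])
  also have "\<dots> = card (T - N) * card N" by simp
  also have "\<dots> \<le> (card (T - N) + card N)\<^sup>2 div 4" by (rule mult_le_quarter_square)
  also have "card (T - N) + card N = card T"
    using N assms(1) card_mono[OF assms(1) N] finite_neighbours
    by (simp add: N_def card_Diff_subset)
  finally show ?thesis .
qed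

section \<open>One side \<open>X\<close> of a separation by \<open>S\<close>, with an edge inside
  \<open>X\<close>\<close>

context
  fixes X S :: "'a set" and \<delta> :: nat and u v
  assumes fin: "finite X" "finite S" and disj: "X \<inter> S = {}"
    and closed: "\<And>e. e \<in> E \<Longrightarrow> e \<inter> X \<noteq> {} \<Longrightarrow> e \<subseteq> X \<union> S"
    and deg: "\<And>x. x \<in> X \<Longrightarrow> \<delta> \<le> card (neighbours x)"
    and uv: "u \<in> X" "v \<in> X" "{u, v} \<in> E"
begin

lemma neighbours_subset: "x \<in> X \<Longrightarrow> neighbours x \<subseteq> X \<union> S"
  using closed by (force simp: neighbours_def)

lemma neighbours_disjoint: "neighbours u \<inter> neighbours v = {}"
  using no_triangle[of u v] uv by (auto simp: neighbours_def insert_commute)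

lemma side_large: "2 * \<delta> \<le> card X + card S"
proof -
  have "2 * \<delta> \<le> card (neighbours u) + card (neighbours v)"
    using deg[OF uv(1)] deg[OF uv(2)] by simp
  also have "\<dots> = card (neighbours u \<union> neighbours v)"
    using neighbours_disjoint finite_neighbours by (simp add: card_Un_disjoint)
  also have "\<dots> \<le> card (X \<union> S)"
    using fin neighbours_subset uv by (intro card_mono) auto
  finally show ?thesis using fin disj by (simp add: card_Un_disjoint)
qed

text \<open>
  Here \<open>X \<union> S\<close> is bipartite with parts \<open>neighbours v\<close> and \<open>neighbours u\<close> of size \<open>\<delta>\<close>. Neither part
  is contained in \<open>S\<close>, so \<open>S\<close> meets both of them, and at least one of the \<open>\<delta>\<^sup>2\<close> pairs lies in \<open>S\<close>.
\<close>
lemma tight_side_edges: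
  assumes "card X = \<delta>" "card S = \<delta>"
  shows "card {e \<in> E. e \<inter> X \<noteq> {}} < \<delta>\<^sup>2"
proof -
  define A B where "A = neighbours v" and "B = neighbours u"
  have finAB: "finite A" "finite B" using finite_neighbours by (auto simp: A_def B_def)
  have AB0: "A \<inter> B = {}" using neighbours_disjoint by (auto simp: A_def B_def)
  have sub: "A \<union> B \<subseteq> X \<union> S" using neighbours_subset uv by (auto simp: A_def B_def)
  have cXS: "card (X \<union> S) = 2 * \<delta>" using assms fin disj by (simp add: card_Un_disjoint)
  have cU: "card (A \<union> B) = card A + card B" using AB0 finAB by (simp add: card_Un_disjoint)
  have dA: "\<delta> \<le> card A" and dB: "\<delta> \<le> card B" using deg uv by (auto simp: A_def B_def)
  \<comment> \<open>Two disjoint neighbourhoods of size at least \<delta> fit into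
    \<open>2 * \<delta>\<close> vertices only if both have size exactly \<delta> and together they
    fill \<open>X \<union> S\<close>.\<close>
  have le: "card (A \<union> B) \<le> 2 * \<delta>" using card_mono[OF _ sub] fin cXS by simp
  have AB: "A \<union> B = X \<union> S"
    using card_subset_eq[OF _ sub] fin le cXS cU dA dB by simp
  have cA: "card A = \<delta>" and cB: "card B = \<delta>" using le cU dA dB by auto
  have uA: "u \<in> A" and vB: "v \<in> B" using uv by (auto simp: A_def B_def neighbours_def insert_commute)
  have uS: "u \<notin> S" and vS: "v \<notin> S" using uv disj by auto
  \<comment> \<open>As the sizes agree, inclusion would give \<open>S = A\<close>, but
    \<open>u\<close> lies in \<open>A\<close> and not in \<open>S\<close>.\<close>
  have "\<not> S \<subseteq> A" using card_subset_eq[of A S] finAB cA assms(2) uA uS by auto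
  then obtain q where q: "q \<in> S" "q \<in> B" using AB by auto
  have "\<not> S \<subseteq> B" using card_subset_eq[of B S] finAB cB assms(2) vB vS by auto
  then obtain p where p: "p \<in> S" "p \<in> A" using AB by auto
  have "{e \<in> E. e \<inter> X \<noteq> {}} \<subseteq> (\<lambda>(a, b). {a, b}) ` (A \<times> B - {(p, q)})"
  proof
    fix e assume "e \<in> {e \<in> E. e \<inter> X \<noteq> {}}"
    then have e: "e \<in> E" "e \<inter> X \<noteq> {}" by auto
    obtain a b where ab: "e = {a, b}" using e(1) by (rule obtain_edge)
    have "e \<noteq> {p, q}" using e(2) p q disj by auto
    have "a \<in> A \<union> B" "b \<in> A \<union> B" using closed[OF e] ab AB by auto
    moreover have "\<not> (a \<in> A \<and> b \<in> A)" "\<not> (a \<in> B \<and> b \<in> B)"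
      using neighbours_independent e ab by (auto simp: A_def B_def)
    ultimately consider "a \<in> A" "b \<in> B" | "b \<in> A" "a \<in> B" by blast
    then show "e \<in> (\<lambda>(a, b). {a, b}) ` (A \<times> B - {(p, q)})"
    proof cases
      case 1
      then have "(a, b) \<in> A \<times> B - {(p, q)}" using ab \<open>e \<noteq> {p, q}\<close> by auto
      then show ?thesis by (rule rev_image_eqI) (simp add: ab)
    next
      case 2
      then have "(b, a) \<in> A \<times> B - {(p, q)}" using ab \<open>e \<noteq> {p, q}\<close> by auto
      then show ?thesis by (rule rev_image_eqI) (auto simp: ab)
    qed
  qed
  then have "card {e \<in> E. e \<inter> X \<noteq> {}} \<le> card (A \<times> B - {(p, q)})"
    using finAB by (meson card_image_le card_mono finite_Diff finite_SigmaI finite_imageI le_trans)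
  also have "\<dots> < card (A \<times> B)"
    using finAB p q by (intro psubset_card_mono) auto
  finally show ?thesis by (simp add: cA cB card_cartesian_product power2_eq_square)
qed

end

text \<open>Mantel's theorem handles the edges missing \<open>X\<close>. Those meeting
  \<open>X\<close> are kept apart, because they are bounded in two ways: by
  \<open>tight_side_edges\<close> or by Mantel's theorem again.\<close>

lemma card_split:
  assumes "finite Y" "finite S" "Y \<inter> S = {}"
    and "\<And>e. e \<in> E \<Longrightarrow> e \<inter> X = {} \<Longrightarrow> e \<subseteq> Y \<union> S"
  shows "card E \<le> card {e \<in> E. e \<inter> X \<noteq> {}} + (card Y + card S)\<^sup>2 div 4"
proof -
  interpret F: triangle_free_edges "{e \<in> E. e \<inter> X = {}}" by (rule subset_edges) auto
  have "card E = card ({e \<in> E. e \<inter> X \<noteq> {}} \<union> {e \<in> E. e \<inter> X = {}})"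
    by (rule arg_cong[where f = card]) auto
  also have "\<dots> \<le> card {e \<in> E. e \<inter> X \<noteq> {}} + card {e \<in> E. e \<inter> X = {}}"
    by (rule card_Un_le)
  also have "card {e \<in> E. e \<inter> X = {}} \<le> (card (Y \<union> S))\<^sup>2 div 4"
    using assms by (intro F.mantel) auto
  finally show ?thesis using assms by (simp add: card_Un_disjoint)
qed

lemma separated_edges_less:
  assumes fin: "finite X" "finite Y" "finite S"
    and disj: "X \<inter> Y = {}" "X \<inter> S = {}" "Y \<inter> S = {}"
    and sub: "\<And>e. e \<in> E \<Longrightarrow> e \<subseteq> X \<union> Y \<union> S"
    and sep: "\<And>e. e \<in> E \<Longrightarrow> e \<inter> X = {} \<or> e \<inter> Y = {}"
    and deg: "\<And>x. x \<in> X \<union> Y \<Longrightarrow> \<delta> \<le> card (neighbours x)"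
    and X: "u \<in> X" "v \<in> X" "{u, v} \<in> E"
    and Y: "w \<in> Y" "z \<in> Y" "{w, z} \<in> E"
    and S: "card S \<le> \<delta>" and \<delta>: "\<delta> > 0"
  shows "card E < \<delta>\<^sup>2 + (card (X \<union> Y \<union> S) - \<delta>)\<^sup>2 div 4"
proof -
  have cl: "e \<subseteq> X \<union> S" if "e \<in> E" "e \<inter> X \<noteq> {}" for e
    using sub[OF that(1)] sep[OF that(1)] that(2) by blast
  have cl': "e \<subseteq> Y \<union> S" if "e \<in> E" "e \<inter> Y \<noteq> {}" for e
    using sub[OF that(1)] sep[OF that(1)] that(2) by blast
  have out: "e \<subseteq> Y \<union> S" if "e \<in> E" "e \<inter> X = {}" for e
    using sub[OF that(1)] that(2) by blast
  have out': "e \<subseteq> X \<union> S" if "e \<in> E" "e \<inter> Y = {}" for e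
    using sub[OF that(1)] that(2) by blast
  have n: "card (X \<union> Y \<union> S) = card X + card Y + card S"
    using fin disj by (simp add: card_Un_disjoint Int_Un_distrib2)
  have large: "2 * \<delta> \<le> card X + card S" "2 * \<delta> \<le> card Y + card S"
    using side_large[OF fin(1,3) disj(2) cl _ X] side_large[OF fin(2,3) disj(3) cl' _ Y] deg
    by auto
  have E: "card E \<le> card {e \<in> E. e \<inter> X \<noteq> {}} + (card Y + card S)\<^sup>2 div 4"
    using card_split[OF fin(2,3) disj(3) out] .
  have E': "card E \<le> card {e \<in> E. e \<inter> Y \<noteq> {}} + (card X + card S)\<^sup>2 div 4"
    using card_split[OF fin(1,3) disj(2) out'] .
  \<comment> \<open>If \<open>card S = \<delta>\<close>, then \<open>large\<close> makes both sides
    at least \<delta>. Either one side is tight, or both are larger, which is the extra condition of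
    \<open>quarter_square_sum_less\<close>; for smaller \<open>S\<close> that condition is
    vacuous.\<close>
  consider "card S = \<delta>" "card X = \<delta>" | "card S = \<delta>" "card Y = \<delta>"
    | "card S = \<delta> \<Longrightarrow> 2 * \<delta> < card X + card S \<and> 2 * \<delta> < card Y + card S"
    using large by linarith
  then show ?thesis
  proof cases
    case 1
    then have "card {e \<in> E. e \<inter> X \<noteq> {}} < \<delta>\<^sup>2"
      using tight_side_edges[OF fin(1,3) disj(2) cl _ X, of \<delta>] deg by blast
    \<comment> \<open>Now \<open>card Y + card S\<close> is the order minus \<delta>, so the quarter
      square in \<open>E\<close> is already the one wanted.\<close>
    then show ?thesis using E n 1 by (simp add: add.commute)
  next
    case 2
    then have "card {e \<in> E. e \<inter> Y \<noteq> {}} < \<delta>\<^sup>2"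
      using tight_side_edges[OF fin(2,3) disj(3) cl' _ Y, of \<delta>] deg by blast
    then show ?thesis using E' n 2 by simp
  next
    case 3
    interpret F: triangle_free_edges "{e \<in> E. e \<inter> X \<noteq> {}}" by (rule subset_edges) auto
    have "card {e \<in> E. e \<inter> X \<noteq> {}} \<le> (card X + card S)\<^sup>2 div 4"
      using F.mantel[of "X \<union> S"] fin disj cl by (simp add: card_Un_disjoint)
    moreover have "card X + card S + (card Y + card S) - card S = card (X \<union> Y \<union> S)"
      using n by simp
    ultimately show ?thesis
      using E quarter_square_sum_less[OF large S \<delta> 3] by simp
  qed
qed

end

section \<open>Vertex-cuts expressed by edges\<close>

lemma (in wf_digraph) not_connected_iff:
  assumes "verts G \<noteq> {}"
  shows "\<not> Digraph_Component.connected G \<longleftrightarrow>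
    (\<exists>X. X \<noteq> {} \<and> X \<subset> verts G \<and> (\<forall>e\<in>arcs G. tail G e \<in> X \<longleftrightarrow> head G e \<in> X))"
proof -
  let ?R = "rtrancl_on (verts G) ((arcs_ends G)\<^sup>s)"
  show ?thesis
  proof
    assume "\<not> Digraph_Component.connected G"
    then obtain a b where ab: "a \<in> verts G" "b \<in> verts G" "(a, b) \<notin> ?R"
      using assms by (auto simp: connected_conv)
    \<comment> \<open>The weak component of \<open>a\<close>: no arc crosses its boundary in either
      direction, and it misses \<open>b\<close>.\<close>
    define X where "X = {x. (a, x) \<in> ?R}"
    have "tail G e \<in> X \<longleftrightarrow> head G e \<in> X" if "e \<in> arcs G" for e
    proof -
      have "(tail G e, head G e) \<in> (arcs_ends G)\<^sup>s" "(head G e, tail G e) \<in> (arcs_ends G)\<^sup>s"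
        using that by (auto simp: arcs_ends_conv symcl_def)
      then show ?thesis
        using that by (auto simp: X_def intro: rtrancl_on_into_rtrancl_on)
    qed
    moreover have "a \<in> X" "b \<notin> X" using ab by (auto simp: X_def)
    moreover have "X \<subseteq> verts G"
      using in_rtrancl_on_in_F(2) by (fastforce simp: X_def)
    ultimately show "\<exists>X. X \<noteq> {} \<and> X \<subset> verts G \<and> (\<forall>e\<in>arcs G. tail G e \<in> X \<longleftrightarrow> head G e \<in> X)"
      using ab by blast
  next
    assume "\<exists>X. X \<noteq> {} \<and> X \<subset> verts G \<and> (\<forall>e\<in>arcs G. tail G e \<in> X \<longleftrightarrow> head G e \<in> X)"
    then obtain X a b where X: "X \<subseteq> verts G" "\<And>e. e \<in> arcs G \<Longrightarrow> tail G e \<in> X \<longleftrightarrow> head G e \<in> X"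
      and ab: "a \<in> X" "b \<in> verts G" "b \<notin> X" by blast
    have "y \<in> X" if "(a, y) \<in> ?R" for y
      using that
    proof (induction rule: rtrancl_on_induct)
      case base
      then show ?case using ab by simp
    next
      case (step y z)
      then show ?case using X(2) by (auto simp: arcs_ends_conv symcl_def)
    qed
    then show "\<not> Digraph_Component.connected G"
      using ab X(1) by (auto simp: connected_conv)
  qed
qed

context graph
begin

lemma edge_iff: "{u, v} \<in> edges G \<longleftrightarrow> u \<rightarrow>\<^bsub>G\<^esub> v"
proof
  assume "{u, v} \<in> edges G"
  then obtain e where "e \<in> arcs G" "{u, v} = {tail G e, head G e}" by (auto simp: edges_def)
  then have "u \<rightarrow>\<^bsub>G\<^esub> v \<or> v \<rightarrow>\<^bsub>G\<^esub> u" by (auto simp: arcs_ends_conv doubleton_eq_iff)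
  then show "u \<rightarrow>\<^bsub>G\<^esub> v" using graph_symmetric[of v u] by (elim disjE)
qed (auto simp: edges_def arcs_ends_conv)

lemma triangle_free_edges:
  assumes "triangle_free G" shows "triangle_free_edges (edges G)"
proof
  show "finite (edges G)" by (simp add: edges_def)
  show "card e = 2" if "e \<in> edges G" for e
    using that by (auto simp: edges_def card_2_iff dest: no_loops)
  show "{w, u} \<notin> edges G" if "{u, v} \<in> edges G" "{v, w} \<in> edges G" for u v w
    using that assms unfolding triangle_free_def edge_iff by blast
qed

text \<open>Without parallel arcs, \<open>head G\<close> is injective on the arcs leaving
  \<open>v\<close>.\<close>

lemma out_degree_eq_card: "out_degree G v = card {u. {u, v} \<in> edges G}"
proof -
  have "inj_on (head G) (out_arcs G v)"
    by (intro inj_onI no_multi_arcs) (simp_all add: arc_to_ends_def)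
  moreover have "head G ` out_arcs G v = {u. {v, u} \<in> edges G}"
    unfolding edge_iff arcs_ends_conv out_arcs_def by auto
  ultimately have "out_degree G v = card {u. {v, u} \<in> edges G}"
    unfolding out_degree_def by (metis card_image)
  then show ?thesis by (simp add: insert_commute)
qed

lemma min_degree_le: "v \<in> verts G \<Longrightarrow> min_degree G \<le> out_degree G v"
  by (simp add: min_degree_def)

text \<open>\<open>X\<close> is a union of components of \<open>G - S\<close>, but not all of them.
  A single implication replaces the equivalence on arcs because \<open>{x, y}\<close> is quantified
  in both orders.\<close>

lemma vertex_cut_iff:
  "vertex_cut G S \<longleftrightarrow> S \<subset> verts G \<and>
    (\<exists>X. X \<noteq> {} \<and> X \<subset> verts G - S \<and>
      (\<forall>x y. {x, y} \<in> edges G \<longrightarrow> x \<in> X \<longrightarrow> y \<in> X \<union> S))"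
proof (cases "S \<subset> verts G")
  case True
  interpret H: wf_digraph "G \<restriction> (verts G - S)" by (rule wellformed_induce_subgraph)
  have "(\<forall>e\<in>arcs (G \<restriction> (verts G - S)). tail G e \<in> X \<longleftrightarrow> head G e \<in> X) \<longleftrightarrow>
      (\<forall>x y. {x, y} \<in> edges G \<longrightarrow> x \<in> X \<longrightarrow> y \<in> X \<union> S)" (is "?L \<longleftrightarrow> ?R")
    if "X \<subset> verts G - S" for X
  proof
    assume ?L
    then show ?R using that by (fastforce simp: edge_iff arcs_ends_conv)
  next
    assume R: ?R
    show ?L
    proof
      fix e assume e: "e \<in> arcs (G \<restriction> (verts G - S))"
      then have "{tail G e, head G e} \<in> edges G" "{head G e, tail G e} \<in> edges G"
        by (auto simp: edges_def)
      with R e show "tail G e \<in> X \<longleftrightarrow> head G e \<in> X" by auto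
    qed
  qed
  then have "(\<exists>X. X \<noteq> {} \<and> X \<subset> verts G - S \<and>
        (\<forall>e\<in>arcs (G \<restriction> (verts G - S)). tail G e \<in> X \<longleftrightarrow> head G e \<in> X)) \<longleftrightarrow>
      (\<exists>X. X \<noteq> {} \<and> X \<subset> verts G - S \<and>
        (\<forall>x y. {x, y} \<in> edges G \<longrightarrow> x \<in> X \<longrightarrow> y \<in> X \<union> S))"
    by (intro ex_cong1 conj_cong refl)
  \<comment> \<open>Strictness of \<open>S \<subset> verts G\<close> is what counts here: the null
    graph is not connected, yet has no such \<open>X\<close>.\<close>
  moreover have "verts (G \<restriction> (verts G - S)) \<noteq> {}" using True by auto
  note H.not_connected_iff[OF this]
  ultimately show ?thesis
    unfolding vertex_cut_def by (simp only: True simp_thms induce_subgraph_verts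
        induce_subgraph_tail induce_subgraph_head)
qed (simp add: vertex_cut_def)

text \<open>Strong components need reachability both ways, so it is enough that no arc enters
  \<open>v\<close>: then only \<open>v\<close> itself reaches \<open>v\<close>.\<close>

lemma isolated_in_sccs:
  assumes "v \<in> T" and "\<And>u. u \<in> T \<Longrightarrow> {u, v} \<notin> edges G"
  shows "\<exists>C \<in> pre_digraph.sccs (G \<restriction> T). verts C = {v}"
proof -
  interpret H: wf_digraph "G \<restriction> T" by (rule wellformed_induce_subgraph)
  have no: "\<not> u \<rightarrow>\<^bsub>G \<restriction> T\<^esub> v" for u
    using assms(2) by (auto simp: arcs_ends_conv edges_def)
  have "u = v" if "u \<rightarrow>\<^sup>*\<^bsub>G \<restriction> T\<^esub> v" for u
    using that by (induction rule: H.converse_reachable_induct) (use no in auto)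
  then have "{v} \<in> H.sccs_verts" using assms(1) by (auto simp: H.sccs_verts_def)
  then have "(G \<restriction> T) \<restriction> {v} \<in> H.sccs" by (auto simp: H.sccs_conv_sccs_verts)
  then show ?thesis by (intro bexI[of _ "(G \<restriction> T) \<restriction> {v}"]) auto
qed

end

section \<open>Minimum cuts and the bound on the number of edges\<close>

theorem theorem5p4:
  fixes G :: "('a, 'b) pre_digraph" and n m \<delta> :: nat
  assumes "graph G"
    and "Digraph_Component.connected G"
    and "triangle_free G"
    and "n = card (verts G)"
    and "m = card (edges G)"
    and "\<delta> = min_degree G"
    and "\<delta> \<ge> 2"
    and "int m \<ge> int \<delta> ^ 2 + \<lfloor>(1 / 4) * (real n - real \<delta>) ^ 2\<rfloor>"
  shows "super_connected G"
proof -
  interpret graph G by fact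
  interpret triangle_free_edges "edges G" using assms(3) by (rule triangle_free_edges)
  have nonempty: "verts G \<noteq> {}" using assms(2) by (auto simp: connected_conv)
  have deg_eq: "out_degree G v = card (neighbours v)" for v
    by (simp add: out_degree_eq_card neighbours_def)
  have deg: "\<delta> \<le> card (neighbours v)" if "v \<in> verts G" for v
    using min_degree_le[OF that] assms(6) deg_eq by simp
  have in_verts: "u \<in> verts G" "v \<in> verts G" if "{u, v} \<in> edges G" for u v
    using that adj_in_verts by (auto simp: edge_iff)
  have "\<delta> \<in> out_degree G ` verts G"
    unfolding assms(6) min_degree_def using nonempty by (intro Min_in) auto
  then obtain v0 where v0: "v0 \<in> verts G" "card (neighbours v0) = \<delta>"
    by (auto simp: deg_eq)
  obtain u0 where u0: "u0 \<in> neighbours v0"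
    using v0(2) assms(7) by fastforce
  \<comment> \<open>This cut shows that a minimum cut has at most \<delta> vertices. As \<delta> is
    at least 2, a neighbour \<open>u0\<close> of \<open>v0\<close> has a second neighbour
    \<open>w\<close>; without triangles \<open>w\<close> is not adjacent to \<open>v0\<close>, so it
    survives on the other side.\<close>
  have cut0: "vertex_cut G (neighbours v0)"
  proof -
    have "neighbours v0 \<subseteq> verts G" using in_verts by (auto simp: neighbours_def)
    have "v0 \<notin> neighbours v0" using edge_neq[of v0 v0] by (auto simp: neighbours_def)
    have "u0 \<in> verts G" using u0 in_verts by (auto simp: neighbours_def)
    then have "\<delta> \<le> card (neighbours u0)" by (rule deg)
    then have "\<not> neighbours u0 \<subseteq> {v0}"
      using assms(7) card_mono[of "{v0}" "neighbours u0"] by auto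
    then obtain w where w: "w \<in> neighbours u0" "w \<noteq> v0" by auto
    have "w \<notin> neighbours v0"
      using neighbours_independent[of u0 v0 w] u0 w by (auto simp: neighbours_def insert_commute)
    moreover have "w \<in> verts G" using w in_verts by (auto simp: neighbours_def)
    ultimately show ?thesis
      using \<open>neighbours v0 \<subseteq> verts G\<close> \<open>v0 \<notin> neighbours v0\<close> v0(1) w(2) unfolding vertex_cut_iff
      by (intro conjI exI[of _ "{v0}"]) (auto simp: neighbours_def insert_commute)
  qed
  show ?thesis unfolding super_connected_def
  proof (intro allI impI)
    fix S assume S: "minimum_vertex_cut G S"
    have cS: "card S \<le> \<delta>"
      using S cut0 v0(2) unfolding minimum_vertex_cut_def by metis
    obtain X where SV: "S \<subset> verts G" and X: "X \<noteq> {}" "X \<subset> verts G - S"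
      and sep: "\<And>x y. {x, y} \<in> edges G \<Longrightarrow> x \<in> X \<Longrightarrow> y \<in> X \<union> S"
      using S unfolding minimum_vertex_cut_def vertex_cut_iff by blast
    have finS: "finite S" using SV by (auto intro: finite_subset[OF _ finite_verts])
    \<comment> \<open>Otherwise each vertex outside \<open>S\<close> has a neighbour outside
      \<open>S\<close>, necessarily on its own side. Both sides then contain an edge, as
      \<open>separated_edges_less\<close> demands.\<close>
    have "\<exists>v \<in> verts G - S. \<forall>u \<in> verts G - S. {u, v} \<notin> edges G"
    proof (rule ccontr)
      assume "\<not> ?thesis"
      then have nb: "\<exists>u \<in> verts G - S. {u, v} \<in> edges G" if "v \<in> verts G - S" for v
        using that by blast
      define Y where "Y = verts G - S - X"
      have V: "verts G = X \<union> Y \<union> S" using X SV by (auto simp: Y_def)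
      obtain u v where uv: "u \<in> X" "v \<in> X" "{u, v} \<in> edges G"
      proof -
        obtain u where u: "u \<in> X" using X by auto
        then obtain v where v: "v \<in> verts G - S" "{v, u} \<in> edges G"
          using nb X by blast
        then have "v \<in> X" using sep[of u v] u by (auto simp: insert_commute)
        with u v that show ?thesis by blast
      qed
      obtain w z where wz: "w \<in> Y" "z \<in> Y" "{w, z} \<in> edges G"
      proof -
        obtain w where w: "w \<in> Y" using X by (auto simp: Y_def)
        then obtain z where z: "z \<in> verts G - S" "{z, w} \<in> edges G"
          using nb by (auto simp: Y_def)
        then have "z \<in> Y" using sep[OF z(2)] w by (auto simp: Y_def)
        with w z that show ?thesis by blast
      qed
      have "card (edges G) < \<delta>\<^sup>2 + (card (X \<union> Y \<union> S) - \<delta>)\<^sup>2 div 4"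
      proof (rule separated_edges_less[OF _ _ finS _ _ _ _ _ _ uv wz cS])
        show "finite X" "finite Y" using V finite_verts by (metis finite_Un)+
        show "X \<inter> Y = {}" "X \<inter> S = {}" "Y \<inter> S = {}" using X by (auto simp: Y_def)
        show "e \<subseteq> X \<union> Y \<union> S" if "e \<in> edges G" for e
          using that unfolding V[symmetric] edges_def by auto
        show "e \<inter> X = {} \<or> e \<inter> Y = {}" if e: "e \<in> edges G" for e
        proof -
          obtain a b where "e = {a, b}" using e by (rule obtain_edge)
          then show ?thesis
            using sep[of a b] sep[of b a] e X by (auto simp: Y_def insert_commute)
        qed
        show "\<delta> \<le> card (neighbours x)" if "x \<in> X \<union> Y" for x
          using that V by (intro deg) auto
        show "\<delta> > 0" using assms(7) by simp
      qed
      then have less: "m < \<delta>\<^sup>2 + (n - \<delta>)\<^sup>2 div 4" using assms(4,5) V by simp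
      have "neighbours v0 \<subseteq> verts G" using in_verts by (auto simp: neighbours_def)
      \<comment> \<open>With this, truncated subtraction agrees with real subtraction, and the floor
        becomes \<open>div\<close>.\<close>
      then have "\<delta> \<le> n" using card_mono[of "verts G" "neighbours v0"] v0(2) assms(4) by simp
      then have "(1 / 4) * (real n - real \<delta>)\<^sup>2 = real ((n - \<delta>)\<^sup>2) / real 4"
        by (simp add: of_nat_diff)
      then have "\<lfloor>(1 / 4) * (real n - real \<delta>)\<^sup>2\<rfloor> = int ((n - \<delta>)\<^sup>2 div 4)"
        by (simp only: floor_divide_of_nat_eq)
      then have "int (\<delta>\<^sup>2 + (n - \<delta>)\<^sup>2 div 4) \<le> int m" using assms(8) by simp
      with less show False by linarith
    qed
    then obtain v where v: "v \<in> verts G - S" "\<And>u. u \<in> verts G - S \<Longrightarrow> {u, v} \<notin> edges G"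
      by blast
    \<comment> \<open>Isolation alone forces minimum degree: all neighbours of \<open>v\<close> lie
      in \<open>S\<close>, which has at most \<delta> elements.\<close>
    have "neighbours v \<subseteq> S" using v(2) in_verts by (auto simp: neighbours_def)
    then have "card (neighbours v) \<le> \<delta>" using card_mono[OF finS] cS order_trans by blast
    then have "out_degree G v = min_degree G"
      using deg[of v] v(1) deg_eq assms(6) by simp
    moreover obtain C where "C \<in> pre_digraph.sccs (G \<restriction> (verts G - S))" "verts C = {v}"
      using isolated_in_sccs[of v "verts G - S"] v by blast
    ultimately show "\<exists>C \<in> pre_digraph.sccs (G \<restriction> (verts G - S)).
        \<exists>v. verts C = {v} \<and> out_degree G v = min_degree G" by blast
  qed
qed

end
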